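(* Let $\psi$ be a function of $x=\{x^1,\dots,x^n\}$, let $\gamma_0$ and $\Lambda_0$ be non-zero constants, and let $F^1,\dots,F^n$ be functions of $x$ satisfying $$\frac{\partial F^b}{\partial x^a}=\Lambda_0\,\delta_a^b .$$ Consider, in the coordinates $(x,p,z)$ of the $(2n+1)$-dimensional contact manifold $(\mathcal{C},\lambda=dz-p_a\,dx^a)$, the dynamical system $$\frac{dx^a}{dt}=F^a(x),\qquad \frac{d\Delta_a}{dt}=-\frac{\partial F^b}{\partial x^a}\Delta_b-\frac{d\Gamma}{d\Delta_0}\Delta_a,\qquad \frac{d\Delta_0}{dt}=-\Gamma(\Delta_0),\qquad \Gamma(\Delta_0)=\gamma_0\Delta_0 .$$ If $\Lambda_0+\gamma_0>0$ and $\gamma_0>0$, then the flow asymptotically approaches the embedded Legendre submanifold $\mathcal{A}_\psi^{\mathcal{C}}$.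
   Context: Everything is smooth; repeated indices are summed over $1,\dots,n$. Here $\Delta_0=\psi(x)-z$ and $\Delta_a=\frac{\partial\psi}{\partial x^a}(x)-p_a$, so that the system is a system of ODEs for $(x,p,z)$ (it is the flow of the contact Hamiltonian vector field of $h=\Delta_aF^a+\Gamma(\Delta_0)$). The embedded Legendre submanifold generated by $\psi$ is $\mathcal{A}_\psi^{\mathcal{C}}=\{\Delta_0=\Delta_1=\dots=\Delta_n=0\}=\{p_a=\partial\psi/\partial x^a,\ z=\psi(x)\}$. "The flow asymptotically approaches $\mathcal{A}_\psi^{\mathcal{C}}$" means that along every solution $(x(t),p(t),z(t))$, $t\ge0$, one has $\lim_{t\to\infty}\Delta_0(t)=0$ and $\lim_{t\to\infty}\Delta_a(t)=0$ for all $a\in\{1,\dots,n\}$. *)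

theory Defs
  imports "HOL-Analysis.Analysis"
begin

text \<open>Points of a coordinate chart of the contact manifold are triples \<open>(x, p, z)\<close> of type
  \<open>(real ^ 'n) \<times> (real ^ 'n) \<times> real\<close>; the chart itself is an open set \<open>W\<close> of such triples, so
  that \<open>fst ` W\<close> is the (open) range of the coordinate \<open>x\<close>.\<close>

definition partial_deriv :: "'n \<Rightarrow> (real ^ 'n \<Rightarrow> real) \<Rightarrow> real ^ 'n \<Rightarrow> real" where
  "partial_deriv a f x = deriv (\<lambda>s. f (x + s *\<^sub>R axis a 1)) 0"

text \<open>Smoothness is only meant to be used on open sets, where the values of \<open>f\<close> outside \<open>U\<close>
  do not influence the partial derivatives on \<open>U\<close>.\<close>

fun Ck_on :: "nat \<Rightarrow> (real ^ 'n) set \<Rightarrow> (real ^ 'n \<Rightarrow> real) \<Rightarrow> bool" where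
  "Ck_on 0 U f \<longleftrightarrow> continuous_on U f"
| "Ck_on (Suc k) U f \<longleftrightarrow>
     (\<forall>x\<in>U. f differentiable (at x)) \<and> (\<forall>a. Ck_on k U (partial_deriv a f))"

definition smooth_on :: "(real ^ 'n) set \<Rightarrow> (real ^ 'n \<Rightarrow> real) \<Rightarrow> bool" where
  "smooth_on U f \<longleftrightarrow> (\<forall>k. Ck_on k U f)"

definition Delta0 :: "(real ^ 'n \<Rightarrow> real) \<Rightarrow> real ^ 'n \<Rightarrow> real \<Rightarrow> real" where
  "Delta0 \<psi> x z = \<psi> x - z"

definition Delta :: "(real ^ 'n \<Rightarrow> real) \<Rightarrow> 'n \<Rightarrow> real ^ 'n \<Rightarrow> real ^ 'n \<Rightarrow> real" where
  "Delta \<psi> a x p = partial_deriv a \<psi> x - p $ a"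

definition legendre_submanifold ::
  "((real ^ 'n) \<times> (real ^ 'n) \<times> real) set \<Rightarrow> (real ^ 'n \<Rightarrow> real)
     \<Rightarrow> ((real ^ 'n) \<times> (real ^ 'n) \<times> real) set" where
  "legendre_submanifold W \<psi> =
     {(x, p, z). (x, p, z) \<in> W \<and> (\<forall>a. p $ a = partial_deriv a \<psi> x) \<and> z = \<psi> x}"

lemma legendre_submanifold_Delta:
  "legendre_submanifold W \<psi> =
     {(x, p, z). (x, p, z) \<in> W \<and> Delta0 \<psi> x z = 0 \<and> (\<forall>a. Delta \<psi> a x p = 0)}"
  unfolding legendre_submanifold_def Delta0_def Delta_def by fastforce

text \<open>The system prescribes the derivatives of \<open>x\<close> and of \<open>Delta\<close>, \<open>Delta0\<close> along the curve.
  For smooth \<open>\<psi>\<close> these equations force \<open>p\<close> and \<open>z\<close> to be differentiable, so this need not be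
  demanded separately. At \<open>t = 0\<close> the derivatives are one-sided.\<close>

definition is_solution ::
  "((real ^ 'n) \<times> (real ^ 'n) \<times> real) set \<Rightarrow> (real ^ 'n \<Rightarrow> real)
     \<Rightarrow> (real ^ 'n \<Rightarrow> real ^ 'n) \<Rightarrow> (real \<Rightarrow> real)
     \<Rightarrow> (real \<Rightarrow> real ^ 'n) \<Rightarrow> (real \<Rightarrow> real ^ 'n) \<Rightarrow> (real \<Rightarrow> real) \<Rightarrow> bool" where
  "is_solution W \<psi> F \<Gamma> x p z \<longleftrightarrow>
     (\<forall>t\<ge>0. (x t, p t, z t) \<in> W
       \<and> (\<forall>a. ((\<lambda>s. x s $ a) has_real_derivative F (x t) $ a) (at t within {0..}))
       \<and> (\<forall>a. ((\<lambda>s. Delta \<psi> a (x s) (p s)) has_real_derivative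
              - (\<Sum>b\<in>UNIV. partial_deriv a (\<lambda>y. F y $ b) (x t) * Delta \<psi> b (x t) (p t))
              - deriv \<Gamma> (Delta0 \<psi> (x t) (z t)) * Delta \<psi> a (x t) (p t))
             (at t within {0..}))
       \<and> ((\<lambda>s. Delta0 \<psi> (x s) (z s)) has_real_derivative
              - \<Gamma> (Delta0 \<psi> (x t) (z t))) (at t within {0..}))"

text \<open>The flow asymptotically approaches \<open>legendre_submanifold W \<psi>\<close>: its defining functions
  (see \<open>legendre_submanifold_Delta\<close>) tend to zero along every solution. This is not
  convergence to the submanifold in the metric of the coordinate space.\<close>

definition flow_approaches_legendre_submanifold ::
  "((real ^ 'n) \<times> (real ^ 'n) \<times> real) set \<Rightarrow> (real ^ 'n \<Rightarrow> real)
     \<Rightarrow> (real ^ 'n \<Rightarrow> real ^ 'n) \<Rightarrow> (real \<Rightarrow> real) \<Rightarrow> bool" where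
  "flow_approaches_legendre_submanifold W \<psi> F \<Gamma> \<longleftrightarrow>
     (\<forall>x p z. is_solution W \<psi> F \<Gamma> x p z \<longrightarrow>
        ((\<lambda>t. Delta0 \<psi> (x t) (z t)) \<longlongrightarrow> 0) at_top
        \<and> (\<forall>a. ((\<lambda>t. Delta \<psi> a (x t) (p t)) \<longlongrightarrow> 0) at_top))"

end

theory Submission
  imports Defs "HOL-Real_Asymp.Real_Asymp"
begin

text \<open>Along a solution each defining function of the submanifold obeys a scalar equation f' =
  -c f. For \<open>Delta0\<close> the rate is c = \<open>\<gamma>0\<close>. For \<open>Delta\<close>
  the equations decouple: the Jacobian of \<open>F\<close> is \<open>\<Lambda>0\<close> times the
  identity over the chart and the derivative of \<Gamma> is the constant \<open>\<gamma>0\<close>,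
  so every component has the rate c = \<open>\<Lambda>0 + \<gamma>0\<close>. Both rates are
  positive, hence all these functions decay exponentially. \<open>linear_ode_solution\<close> solves
  the scalar equation and \<open>linear_ode_tendsto_0\<close> takes the limit.\<close>

lemma linear_ode_solution:
  fixes f :: "real \<Rightarrow> real"
  assumes deriv: "\<And>t. t \<ge> 0 \<Longrightarrow> (f has_real_derivative - c * f t) (at t within {0..})"
    and "t \<ge> 0"
  shows "f t = f 0 * exp (- c * t)"
proof -
  \<comment> \<open>Integrating factor: the two terms of the product rule cancel, so
    \<open>g\<close> is constant on the convex set \<open>{0..}\<close>. Derivatives within
    \<open>{0..}\<close> suffice for this, including the one-sided one at 0.\<close>
  define g where "g = (\<lambda>t. f t * exp (c * t))"
  have "(g has_real_derivative 0) (at s within {0..})" if "s \<in> {0..}" for s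
    unfolding g_def using that
    by (auto intro!: derivative_eq_intros deriv)
  then obtain k where k: "\<And>s. s \<in> {0..} \<Longrightarrow> g s = k"
    using has_field_derivative_zero_constant[OF convex_real_interval(1)] by blast
  have "f t * exp (c * t) = f 0"
    using k[of t] k[of 0] \<open>t \<ge> 0\<close> by (simp add: g_def)
  then show ?thesis
    by (simp add: exp_minus field_simps)
qed

lemma linear_ode_tendsto_0:
  fixes f :: "real \<Rightarrow> real"
  assumes "\<And>t. t \<ge> 0 \<Longrightarrow> (f has_real_derivative - c * f t) (at t within {0..})"
    and "c > 0"
  shows "(f \<longlongrightarrow> 0) at_top"
proof -
  have "((\<lambda>t. f 0 * exp (- c * t)) \<longlongrightarrow> 0) at_top"
    using \<open>c > 0\<close> by real_asymp
  \<comment> \<open>The explicit formula is known for nonnegative times only, which is enough for a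
    limit at infinity.\<close>
  moreover have "\<forall>\<^sub>F t in at_top. f 0 * exp (- c * t) = f t"
    using eventually_ge_at_top[of 0]
    by eventually_elim (rule linear_ode_solution[OF assms(1), symmetric])
  ultimately show ?thesis
    by (rule Lim_transform_eventually)
qed

theorem theorem4p3:
  fixes W :: "((real ^ 'n) \<times> (real ^ 'n) \<times> real) set"
    and \<psi> :: "real ^ 'n \<Rightarrow> real"
    and F :: "real ^ 'n \<Rightarrow> real ^ 'n"
    and \<gamma>0 \<Lambda>0 :: real
  assumes "open W"
    and "smooth_on (fst ` W) \<psi>"
    and "\<forall>b. smooth_on (fst ` W) (\<lambda>x. F x $ b)"
    and "\<gamma>0 \<noteq> 0" and "\<Lambda>0 \<noteq> 0"
    and "\<forall>x \<in> fst ` W. \<forall>a b. partial_deriv a (\<lambda>y. F y $ b) x = (if a = b then \<Lambda>0 else 0)"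
    and "\<Lambda>0 + \<gamma>0 > 0" and "\<gamma>0 > 0"
  shows "flow_approaches_legendre_submanifold W \<psi> F (\<lambda>s. \<gamma>0 * s)"
  unfolding flow_approaches_legendre_submanifold_def
proof (intro allI impI conjI)
  fix x p z
  assume sol: "is_solution W \<psi> F (\<lambda>s. \<gamma>0 * s) x p z"
  show "((\<lambda>t. Delta0 \<psi> (x t) (z t)) \<longlongrightarrow> 0) at_top"
    by (rule linear_ode_tendsto_0[OF _ \<open>\<gamma>0 > 0\<close>]) (use sol in \<open>simp add: is_solution_def\<close>)
  fix a
  \<comment> \<open>Linearity of \<Gamma> makes this coefficient independent of
    \<open>Delta0\<close>, so the equations for \<open>Delta\<close> have constant
    coefficients.\<close>
  have \<Gamma>': "deriv (\<lambda>s. \<gamma>0 * s) y = \<gamma>0" for y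
    by (rule DERIV_imp_deriv) (auto intro!: derivative_eq_intros)
  show "((\<lambda>t. Delta \<psi> a (x t) (p t)) \<longlongrightarrow> 0) at_top"
  proof (rule linear_ode_tendsto_0[OF _ \<open>\<Lambda>0 + \<gamma>0 > 0\<close>])
    fix t :: real
    assume "t \<ge> 0"
    \<comment> \<open>The Jacobian of \<open>F\<close> is prescribed only over the chart, in which
      the solution stays.\<close>
    then have "x t \<in> fst ` W"
      using sol by (force simp: is_solution_def)
    then have "(\<Sum>b\<in>UNIV. partial_deriv a (\<lambda>y. F y $ b) (x t) * Delta \<psi> b (x t) (p t))
        = (\<Sum>b\<in>UNIV. if a = b then \<Lambda>0 * Delta \<psi> b (x t) (p t) else 0)"
      using assms(6) by (intro sum.cong) auto
    also have "\<dots> = \<Lambda>0 * Delta \<psi> a (x t) (p t)"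
      by simp
    finally have sum: "(\<Sum>b\<in>UNIV. partial_deriv a (\<lambda>y. F y $ b) (x t) * Delta \<psi> b (x t) (p t))
        = \<Lambda>0 * Delta \<psi> a (x t) (p t)" .
    have "((\<lambda>t. Delta \<psi> a (x t) (p t)) has_real_derivative
        - (\<Sum>b\<in>UNIV. partial_deriv a (\<lambda>y. F y $ b) (x t) * Delta \<psi> b (x t) (p t))
        - deriv (\<lambda>s. \<gamma>0 * s) (Delta0 \<psi> (x t) (z t)) * Delta \<psi> a (x t) (p t)) (at t within {0..})"
      using sol \<open>t \<ge> 0\<close> unfolding is_solution_def by blast
    \<comment> \<open>Both terms are now multiples of the same component, so their rates add
      up.\<close>
    then show "((\<lambda>t. Delta \<psi> a (x t) (p t)) has_real_derivative
        - (\<Lambda>0 + \<gamma>0) * Delta \<psi> a (x t) (p t)) (at t within {0..})"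
      unfolding sum \<Gamma>' by (simp add: algebra_simps)
  qed
qed

end
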